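(* Let $V$ be a vector space over a field $\mathbb{K}$ and let $\mathcal F=\{\langle\cdot,\cdot\rangle_i\}_{i\in I}$ be a simultaneously orthogonalizable family of inner products on $V$ satisfying the descending chain condition on radicals. Then there is a finite subset $F\subset I$ such that $$\bigcap_{i\in F}\mathrm{rad}(\langle\cdot,\cdot\rangle_i)=\mathrm{rad}(\mathcal F).$$ Furthermore, if $\mathrm{rad}(\mathcal F)=0$ and $\mathrm{card}(\mathbb{K})>\dim(V)$, then there exists a linear combination of elements of $\mathcal F$ which is nondegenerate.
   Context: An inner product on a $\mathbb{K}$-vector space $V$ is a symmetric bilinear form $\langle\cdot,\cdot\rangle\colon V\times V\to\mathbb{K}$; its radical is $\mathrm{rad}(\langle\cdot,\cdot\rangle)=\{x\in V\colon\langle x,V\rangle=0\}$, and it is nondegenerate if its radical is $0$. A family $\{\langle\cdot,\cdot\rangle_i\}_{i\in I}$ is simultaneously orthogonalizable if there is a basis $\{v_j\}$ of $V$ with $\langle v_j,v_k\rangle_i=0$ for all $i\in I$ and all $j\neq k$. The radical of the family is $\mathrm{rad}(\mathcal F):=\bigcap_{i\in I}\mathrm{rad}(\langle\cdot,\cdot\rangle_i)$. For a finite subset $F\subset I$ put $R_F:=\bigcap_{i\in F}\mathrm{rad}(\langle\cdot,\cdot\rangle_i)$. $\mathcal F$ satisfies the descending chain condition on radicals if for any sequence $F_1,F_2,\dots$ of finite subsets of $I$ with $R_{F_1}\supset R_{F_2}\supset\cdots$ there is some $n$ such that $R_{F_n}=R_{F_m}$ for all $m\ge n$. *)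

theory Defs
  imports Complex_Main
begin

unbundle cardinal_syntax

definition is_basis :: "('k::field \<Rightarrow> 'v::ab_group_add \<Rightarrow> 'v) \<Rightarrow> 'v set \<Rightarrow> bool" where
  "is_basis scale B \<longleftrightarrow> \<not> module.dependent scale B \<and> module.span scale B = UNIV"

text \<open>The library's \<open>dim\<close> is a natural number and is \<open>0\<close> on infinite-dimensional spaces.
  The dimension below is a cardinal, to be compared with others by \<open><o\<close> and \<open>=o\<close>;
  its independence of the chosen basis is \<open>card_dim_eq\<close>.\<close>

definition card_dim :: "('k::field \<Rightarrow> 'v::ab_group_add \<Rightarrow> 'v) \<Rightarrow> 'v rel" where
  "card_dim scale = |SOME B. is_basis scale B|"

lemma is_basis_card_le:
  assumes "vector_space scale" "is_basis scale B" "is_basis scale C"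
  shows "|C| \<le>o |B|"
proof -
  interpret vector_space scale by fact
  have B: "independent B" "span B = UNIV" and C: "independent C" "span C = UNIV"
    using assms(2,3) by (auto simp: is_basis_def)
  show ?thesis
  proof (cases "finite B")
    case True
    then have "finite C" "card C \<le> card B"
      using independent_span_bound[OF True C(1)] B(2) by auto
    with True show ?thesis
      using inj_on_iff_card_le[of C B] card_of_ordLeq[of C B] by blast
  next
    case False
    have "\<exists>T. finite T \<and> T \<subseteq> C \<and> b \<in> span T" for b
    proof -
      have "b \<in> span C" using C(2) by simp
      then obtain T r where "finite T" "T \<subseteq> C" "b = (\<Sum>a\<in>T. scale (r a) a)"
        unfolding span_explicit by blast
      moreover from this have "b \<in> span T"
        by (simp add: span_sum span_scale span_base)
      ultimately show ?thesis by blast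
    qed
    then obtain T where T: "\<And>b. finite (T b)" "\<And>b. T b \<subseteq> C" "\<And>b. b \<in> span (T b)"
      by metis
    let ?D = "\<Union>b\<in>B. T b"
    have "b \<in> span ?D" if "b \<in> B" for b
      using T(3)[of b] span_mono[of "T b" ?D] that by blast
    then have "span B \<subseteq> span ?D"
      by (intro span_minimal subspace_span) auto
    then have "C \<subseteq> span ?D" using B(2) by auto
    then have "?D = C"
      using spanning_subset_independent[of ?D C] T(2) C(1) by blast
    moreover have "|?D| \<le>o |B|"
    proof (rule card_of_UNION_ordLeq_infinite[OF False])
      show "|B| \<le>o |B|" by (rule ordLeq_refl[OF card_of_Card_order])
      show "\<forall>b\<in>B. |T b| \<le>o |B|"
        using T(1) False card_of_ordLeq_finite ordLeq_total[OF card_of_Well_order card_of_Well_order]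
        by blast
    qed
    ultimately show ?thesis by simp
  qed
qed

lemma card_dim_eq:
  assumes "vector_space scale" "is_basis scale B"
  shows "card_dim scale =o |B|"
proof -
  have "is_basis scale (SOME B. is_basis scale B)"
    using assms(2) by (rule someI)
  then show ?thesis
    using assms is_basis_card_le unfolding card_dim_def ordIso_iff_ordLeq by blast
qed

definition inner_product ::
  "('k::field \<Rightarrow> 'v::ab_group_add \<Rightarrow> 'v) \<Rightarrow> ('v \<Rightarrow> 'v \<Rightarrow> 'k) \<Rightarrow> bool" where
  "inner_product scale f \<longleftrightarrow>
     (\<forall>x y. f x y = f y x) \<and>
     (\<forall>x. Vector_Spaces.linear scale (*) (\<lambda>y. f x y)) \<and>
     (\<forall>y. Vector_Spaces.linear scale (*) (\<lambda>x. f x y))"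

definition radical :: "('v \<Rightarrow> 'v \<Rightarrow> 'k::zero) \<Rightarrow> 'v set" where
  "radical f = {x. \<forall>y. f x y = 0}"

definition nondegenerate :: "('v::zero \<Rightarrow> 'v \<Rightarrow> 'k::zero) \<Rightarrow> bool" where
  "nondegenerate f \<longleftrightarrow> radical f = {0}"

text \<open>Since the vector space is a whole type, the radical of the empty family is \<open>UNIV\<close>.\<close>

definition family_radical :: "('i \<Rightarrow> 'v \<Rightarrow> 'v \<Rightarrow> 'k::zero) \<Rightarrow> 'i set \<Rightarrow> 'v set" where
  "family_radical f J = (\<Inter>i\<in>J. radical (f i))"

definition simultaneously_orthogonalizable ::
  "('k::field \<Rightarrow> 'v::ab_group_add \<Rightarrow> 'v) \<Rightarrow> ('i \<Rightarrow> 'v \<Rightarrow> 'v \<Rightarrow> 'k) \<Rightarrow> 'i set \<Rightarrow> bool" where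
  "simultaneously_orthogonalizable scale f I \<longleftrightarrow>
     (\<exists>B. is_basis scale B \<and> (\<forall>i\<in>I. \<forall>v\<in>B. \<forall>w\<in>B. v \<noteq> w \<longrightarrow> f i v w = 0))"

definition dcc_on_radicals :: "('i \<Rightarrow> 'v \<Rightarrow> 'v \<Rightarrow> 'k::zero) \<Rightarrow> 'i set \<Rightarrow> bool" where
  "dcc_on_radicals f I \<longleftrightarrow>
     (\<forall>F :: nat \<Rightarrow> 'i set.
        (\<forall>n. finite (F n) \<and> F n \<subseteq> I) \<longrightarrow>
        (\<forall>n. family_radical f (F (Suc n)) \<subseteq> family_radical f (F n)) \<longrightarrow>
        (\<exists>n. \<forall>m\<ge>n. family_radical f (F n) = family_radical f (F m)))"

end

theory Submission
  imports Defs
begin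

text \<open>
  The finite subset comes from the chain condition alone: as long as a finite intersection of
  radicals is larger than the radical of the family, some further form cuts it down strictly, and
  this cannot go on forever (\<open>finite_subfamily_with_same_radical\<close>).

  For the second claim, an orthogonal basis \<open>B\<close> turns every form \<open>f i\<close> into its diagonal
  \<open>b \<mapsto> f i b b\<close>, and a form that is diagonal in \<open>B\<close> is nondegenerate once its
  diagonal has no zero (\<open>nondegenerate_if_diagonal_nonzero\<close>). If \<open>F\<close> is finite and its common
  radical is \<open>0\<close>, then each \<open>b \<in> B\<close> is detected by the diagonal of some \<open>f i\<close> with
  \<open>i \<in> F\<close>. It remains to find one combination of finitely many functions on \<open>B\<close> that
  vanishes only where all of them do (\<open>combination_without_extra_zeros\<close>). The functions are added
  one at a time. Each \<open>b\<close> then forbids at most one value of the new coefficient, so that fewer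
  than \<open>|UNIV :: 'k set|\<close> values are forbidden. Adding all functions at once, with the powers of
  a single scalar as coefficients, could forbid several scalars for each \<open>b\<close>, which can exhaust
  a finite field.
\<close>

lemma finite_subfamily_with_same_radical:
  assumes "dcc_on_radicals f I"
  shows "\<exists>F. finite F \<and> F \<subseteq> I \<and> family_radical f F = family_radical f I"
proof (rule ccontr)
  assume none: "\<not> ?thesis"
  have "\<exists>i\<in>I. family_radical f (insert i F) \<noteq> family_radical f F" if "finite F" "F \<subseteq> I" for F
  proof (rule ccontr)
    assume "\<not> ?thesis"
    then have "family_radical f F \<subseteq> radical (f i)" if "i \<in> I" for i
      using that unfolding family_radical_def by blast
    then have "family_radical f F = family_radical f I"
      using \<open>F \<subseteq> I\<close> unfolding family_radical_def by blast
    with none that show False by blast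
  qed
  then obtain g where g: "\<And>F. finite F \<Longrightarrow> F \<subseteq> I \<Longrightarrow> g F \<in> I"
      "\<And>F. finite F \<Longrightarrow> F \<subseteq> I \<Longrightarrow> family_radical f (insert (g F) F) \<noteq> family_radical f F"
    by metis
  define F where "F n = ((\<lambda>F. insert (g F) F) ^^ n) {}" for n
  have step: "F (Suc n) = insert (g (F n)) (F n)" for n
    by (simp add: F_def)
  have fin: "finite (F n) \<and> F n \<subseteq> I" for n
  proof (induction n)
    case 0
    show ?case by (simp add: F_def)
  next
    case (Suc n)
    then show ?case using g(1) by (simp add: step)
  qed
  have desc: "family_radical f (F (Suc n)) \<subseteq> family_radical f (F n)" for n
    unfolding step family_radical_def by blast
  from assms[unfolded dcc_on_radicals_def, rule_format, of F] fin desc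
  obtain n where "\<forall>m\<ge>n. family_radical f (F n) = family_radical f (F m)"
    by metis
  then have "family_radical f (F (Suc n)) = family_radical f (F n)"
    by (metis le_SucI order_refl)
  with g(2) fin show False
    by (simp add: step)
qed

text \<open>
  Geometrically, fewer than \<open>|UNIV :: 'k set|\<close> hyperplanes, one for each \<open>b\<close> at which some
  \<open>a i\<close> is nonzero, do not cover the space of coefficient vectors. When an
  index \<open>j\<close> is added, a \<open>b\<close> with \<open>a j b = 0\<close> imposes no condition on its coefficient, since the
  earlier sum at \<open>b\<close> already has the right behaviour, and any other \<open>b\<close> excludes a single value.
\<close>

lemma combination_without_extra_zeros:
  fixes a :: "'i \<Rightarrow> 'b \<Rightarrow> 'k::field"
  assumes "finite F" and small: "|B| <o |UNIV :: 'k set|"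
  shows "\<exists>c. \<forall>b\<in>B. (\<exists>i\<in>F. a i b \<noteq> 0) \<longrightarrow> (\<Sum>i\<in>F. c i * a i b) \<noteq> 0"
  using \<open>finite F\<close>
proof (induction F)
  case empty
  show ?case by simp
next
  case (insert j F)
  then obtain c where c: "\<And>b. b \<in> B \<Longrightarrow> \<exists>i\<in>F. a i b \<noteq> 0 \<Longrightarrow> (\<Sum>i\<in>F. c i * a i b) \<noteq> 0"
    by blast
  define s where "s b = (\<Sum>i\<in>F. c i * a i b)" for b
  define bad where "bad = (\<lambda>b. - s b / a j b) ` B"
  have "|bad| <o |UNIV :: 'k set|"
    unfolding bad_def using card_of_image small by (rule ordLeq_ordLess_trans)
  then have "bad \<noteq> UNIV"
    by (metis card_of_refl not_ordLess_ordIso)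
  then obtain t where t: "t \<notin> bad" by blast
  have "(\<Sum>i\<in>insert j F. (c(j := t)) i * a i b) \<noteq> 0"
    if b: "b \<in> B" and nz: "\<exists>i\<in>insert j F. a i b \<noteq> 0" for b
  proof -
    have "(\<Sum>i\<in>F. (c(j := t)) i * a i b) = s b"
      unfolding s_def using insert.hyps(2) by (intro sum.cong) auto
    then have sum: "(\<Sum>i\<in>insert j F. (c(j := t)) i * a i b) = t * a j b + s b"
      using insert.hyps by simp
    show ?thesis
    proof (cases "a j b = 0")
      case True
      with nz have "\<exists>i\<in>F. a i b \<noteq> 0" by auto
      with c[OF b] have "s b \<noteq> 0"
        unfolding s_def by blast
      with True show ?thesis unfolding sum by simp
    next
      case False
      have "t \<noteq> - s b / a j b"
        using t b unfolding bad_def by blast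
      with False have "t * a j b \<noteq> - s b"
        by (metis nonzero_mult_div_cancel_right)
      then show ?thesis
        unfolding sum by (simp add: eq_neg_iff_add_eq_0)
    qed
  qed
  then show ?case by blast
qed

lemma inner_product_lincomb:
  fixes scale :: "'k::field \<Rightarrow> 'v::ab_group_add \<Rightarrow> 'v"
  assumes "\<And>i. i \<in> S \<Longrightarrow> inner_product scale (f i)" and "vector_space scale"
  shows "inner_product scale (\<lambda>x y. \<Sum>i\<in>S. c i * f i x y)"
proof -
  interpret vector_space scale by fact
  interpret K: vector_space "(*) :: 'k \<Rightarrow> 'k \<Rightarrow> 'k"
    by unfold_locales (simp_all add: algebra_simps)
  interpret vector_space_pair scale "(*) :: 'k \<Rightarrow> 'k \<Rightarrow> 'k" ..
  have "Vector_Spaces.linear scale (*) (\<lambda>y. \<Sum>i\<in>S. c i * f i x y)" for x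
    using assms(1) unfolding inner_product_def
    by (intro linear_compose_sum ballI linear_compose_scale_right) blast
  moreover have "Vector_Spaces.linear scale (*) (\<lambda>x. \<Sum>i\<in>S. c i * f i x y)" for y
    using assms(1) unfolding inner_product_def
    by (intro linear_compose_sum ballI linear_compose_scale_right) blast
  moreover have "(\<Sum>i\<in>S. c i * f i x y) = (\<Sum>i\<in>S. c i * f i y x)" for x y
    using assms(1) unfolding inner_product_def by (intro sum.cong) auto
  ultimately show ?thesis
    unfolding inner_product_def by blast
qed

text \<open>
  Pairing a vector of the radical with a basis vector \<open>b\<close> isolates its coordinate at \<open>b\<close>, up to
  the nonzero factor \<open>g b b\<close>.
\<close>

lemma nondegenerate_if_diagonal_nonzero:
  assumes "vector_space scale" and g: "inner_product scale g" and B: "is_basis scale B"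
    and orth: "\<And>v w. v \<in> B \<Longrightarrow> w \<in> B \<Longrightarrow> v \<noteq> w \<Longrightarrow> g v w = 0"
    and diag: "\<And>b. b \<in> B \<Longrightarrow> g b b \<noteq> 0"
  shows "nondegenerate g"
proof -
  interpret vector_space scale by fact
  have lin: "Vector_Spaces.linear scale (*) (\<lambda>x. g x y)" for y
    using g unfolding inner_product_def by blast
  have "x = 0" if x: "x \<in> radical g" for x
  proof -
    have "x \<in> span B"
      using B by (simp add: is_basis_def)
    then obtain T r where T: "finite T" "T \<subseteq> B" and xr: "x = (\<Sum>a\<in>T. scale (r a) a)"
      unfolding span_explicit by blast
    have "r b = 0" if "b \<in> T" for b
    proof -
      interpret lin: Vector_Spaces.linear scale "(*)" "\<lambda>x. g x b" by (rule lin)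
      have "0 = g x b"
        using x by (simp add: radical_def)
      also have "\<dots> = (\<Sum>a\<in>T. r a * g a b)"
        unfolding xr by (simp add: lin.sum lin.scale)
      also have "\<dots> = (\<Sum>a\<in>T. if a = b then r b * g b b else 0)"
        using T that orth by (intro sum.cong) auto
      also have "\<dots> = r b * g b b"
        using T that by simp
      finally show ?thesis
        using diag T that by auto
    qed
    then show "x = 0"
      unfolding xr by simp
  qed
  moreover have "0 \<in> radical g"
  proof -
    have "g 0 y = 0" for y
    proof -
      interpret lin: Vector_Spaces.linear scale "(*)" "\<lambda>x. g x y" by (rule lin)
      show ?thesis by (rule lin.zero)
    qed
    then show ?thesis by (simp add: radical_def)
  qed
  ultimately show ?thesis
    unfolding nondegenerate_def by blast
qed

lemma orthogonal_to_basis_in_radical: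
  assumes "vector_space scale" and g: "inner_product scale g" and B: "is_basis scale B"
    and "\<And>w. w \<in> B \<Longrightarrow> g v w = 0"
  shows "v \<in> radical g"
proof -
  interpret vector_space scale by fact
  interpret lin: Vector_Spaces.linear scale "(*)" "\<lambda>y. g v y"
    using g unfolding inner_product_def by blast
  have "g v y = 0" for y
  proof -
    have "y \<in> span B"
      using B by (simp add: is_basis_def)
    then show ?thesis
      using assms(4) by (rule lin.eq_0_on_span[rotated])
  qed
  then show ?thesis by (simp add: radical_def)
qed

theorem proposition5:
  fixes scale :: "'k::field \<Rightarrow> 'v::ab_group_add \<Rightarrow> 'v"
    and f :: "'i \<Rightarrow> 'v \<Rightarrow> 'v \<Rightarrow> 'k"
    and I :: "'i set"
  assumes "vector_space scale"
    and "\<And>i. i \<in> I \<Longrightarrow> inner_product scale (f i)"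
    and "simultaneously_orthogonalizable scale f I"
    and "dcc_on_radicals f I"
  shows "(\<exists>F. finite F \<and> F \<subseteq> I \<and> family_radical f F = family_radical f I) \<and>
    (family_radical f I = {0} \<longrightarrow> card_dim scale <o |UNIV :: 'k set| \<longrightarrow>
      (\<exists>S c. finite S \<and> S \<subseteq> I \<and> nondegenerate (\<lambda>x y. \<Sum>i\<in>S. c i * f i x y)))"
proof (intro conjI impI)
  show ex: "\<exists>F. finite F \<and> F \<subseteq> I \<and> family_radical f F = family_radical f I"
    using assms(4) by (rule finite_subfamily_with_same_radical)
  assume rad0: "family_radical f I = {0}" and small: "card_dim scale <o |UNIV :: 'k set|"
  interpret vector_space scale by fact
  from ex rad0 obtain F where F: "finite F" "F \<subseteq> I" "family_radical f F = {0}"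
    by auto
  from assms(3) obtain B where B: "is_basis scale B"
    and orth: "\<And>i v w. i \<in> I \<Longrightarrow> v \<in> B \<Longrightarrow> w \<in> B \<Longrightarrow> v \<noteq> w \<Longrightarrow> f i v w = 0"
    unfolding simultaneously_orthogonalizable_def by blast
  have "|B| <o |UNIV :: 'k set|"
    using ordIso_symmetric[OF card_dim_eq[OF assms(1) B]] small by (rule ordIso_ordLess_trans)
  from combination_without_extra_zeros[OF F(1) this, of "\<lambda>i b. f i b b"]
  obtain c where c: "\<And>b. b \<in> B \<Longrightarrow> \<exists>i\<in>F. f i b b \<noteq> 0 \<Longrightarrow> (\<Sum>i\<in>F. c i * f i b b) \<noteq> 0"
    by blast
  \<comment> \<open>A basis vector isotropic for all forms of \<open>F\<close> would be a nonzero common radical vector.\<close>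
  have detected: "\<exists>i\<in>F. f i b b \<noteq> 0" if b: "b \<in> B" for b
  proof (rule ccontr)
    assume "\<not> ?thesis"
    then have "f i b w = 0" if "i \<in> F" "w \<in> B" for i w
      using orth[of i b w] that b F(2) by blast
    then have "b \<in> family_radical f F"
      unfolding family_radical_def
      using orthogonal_to_basis_in_radical[OF assms(1) assms(2) B] F(2) by blast
    with F(3) have "b = 0" by simp
    moreover have "b \<noteq> 0"
      using B b dependent_zero unfolding is_basis_def by blast
    ultimately show False by simp
  qed
  have "nondegenerate (\<lambda>x y. \<Sum>i\<in>F. c i * f i x y)"
  proof (rule nondegenerate_if_diagonal_nonzero[OF assms(1) _ B])
    show "inner_product scale (\<lambda>x y. \<Sum>i\<in>F. c i * f i x y)"
      using F(2) assms(2) by (intro inner_product_lincomb assms(1)) blast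
    show "(\<Sum>i\<in>F. c i * f i v w) = 0" if "v \<in> B" "w \<in> B" "v \<noteq> w" for v w
      using orth that F(2) by (intro sum.neutral) auto
    show "(\<Sum>i\<in>F. c i * f i b b) \<noteq> 0" if "b \<in> B" for b
      using c detected that by blast
  qed
  with F show "\<exists>S c. finite S \<and> S \<subseteq> I \<and> nondegenerate (\<lambda>x y. \<Sum>i\<in>S. c i * f i x y)"
    by blast
qed

end
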